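(* The ideals $I_1=e_1\mathbb{BC}$ and $I_2=e_2\mathbb{BC}$ are maximal ideals in the ring $\mathbb{BC}$ of bicomplex numbers.
   Context: Bicomplex numbers: $\mathbb{BC}=\{z+jw : z,w\in\mathbb C(i)\}$, where $\mathbb C(i)$ is the complex field with imaginary unit $i$, and $j$ is another imaginary unit with $i^2=j^2=-1$, $ij=ji$. It is a commutative ring with unity under $(z+jw)+(u+jv)=(z+u)+j(w+v)$ and $(z+jw)(u+jv)=(zu-wv)+j(wu+zv)$. Put $e_1=\frac{1+ij}{2}$ and $e_2=\frac{1-ij}{2}$. *)

theory Defs
  imports
    Complex_Main
    "HOL-Algebra.Ideal"
    "HOL-Algebra.Algebraic_Closure_Type"
begin

text \<open>
  \<open>Bicomplex z w\<close> stands for \<open>z + j w\<close>, where \<open>z\<close> and \<open>w\<close> lie in the complex field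
  with imaginary unit \<open>i\<close>.
\<close>

datatype bicomplex = Bicomplex (bc_fst: complex) (bc_snd: complex)

instantiation bicomplex :: comm_ring_1
begin

definition "0 = Bicomplex 0 0"

definition "1 = Bicomplex 1 0"

definition "x + y = Bicomplex (bc_fst x + bc_fst y) (bc_snd x + bc_snd y)"

definition "- x = Bicomplex (- bc_fst x) (- bc_snd x)"

definition "x - y = Bicomplex (bc_fst x - bc_fst y) (bc_snd x - bc_snd y)"

definition "x * y =
  Bicomplex (bc_fst x * bc_fst y - bc_snd x * bc_snd y)
            (bc_snd x * bc_fst y + bc_fst x * bc_snd y)"

instance
  by standard
    (simp_all add: zero_bicomplex_def one_bicomplex_def plus_bicomplex_def
      uminus_bicomplex_def minus_bicomplex_def times_bicomplex_def algebra_simps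
      bicomplex.expand)

end

definition bc_of_complex :: "complex \<Rightarrow> bicomplex" where
  "bc_of_complex z = Bicomplex z 0"

definition bc_i :: bicomplex where
  "bc_i = bc_of_complex \<i>"

definition bc_j :: bicomplex where
  "bc_j = Bicomplex 0 1"

lemma bicomplex_decomp: "Bicomplex z w = bc_of_complex z + bc_j * bc_of_complex w"
  by (simp add: bc_of_complex_def bc_j_def plus_bicomplex_def times_bicomplex_def)

lemma bc_i_square: "bc_i * bc_i = - 1"
  by (simp add: bc_i_def bc_of_complex_def times_bicomplex_def uminus_bicomplex_def
      one_bicomplex_def)

lemma bc_j_square: "bc_j * bc_j = - 1"
  by (simp add: bc_j_def times_bicomplex_def uminus_bicomplex_def one_bicomplex_def)

definition bc_e1 :: bicomplex where
  "bc_e1 = bc_of_complex (1 / 2) * (1 + bc_i * bc_j)"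

definition bc_e2 :: bicomplex where
  "bc_e2 = bc_of_complex (1 / 2) * (1 - bc_i * bc_j)"

definition BC :: "bicomplex ring" where
  "BC = ring_of_type_algebra"

lemma BC_simps [simp]:
  "carrier BC = UNIV" "x \<otimes>\<^bsub>BC\<^esub> y = x * y" "x \<oplus>\<^bsub>BC\<^esub> y = x + y"
  "\<one>\<^bsub>BC\<^esub> = 1" "\<zero>\<^bsub>BC\<^esub> = 0"
  by (simp_all add: BC_def ring_of_type_algebra_def)

lemma cring_BC: "cring BC"
  unfolding BC_def by (rule cring_from_type_algebra)

definition bc_I1 :: "bicomplex set" where
  "bc_I1 = {bc_e1 \<otimes>\<^bsub>BC\<^esub> x | x. x \<in> carrier BC}"

definition bc_I2 :: "bicomplex set" where
  "bc_I2 = {bc_e2 \<otimes>\<^bsub>BC\<^esub> x | x. x \<in> carrier BC}"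

lemma bc_I1_cgenideal: "bc_I1 = PIdl\<^bsub>BC\<^esub> bc_e1"
  by (simp add: bc_I1_def cgenideal_def mult.commute)

lemma bc_I2_cgenideal: "bc_I2 = PIdl\<^bsub>BC\<^esub> bc_e2"
  by (simp add: bc_I2_def cgenideal_def mult.commute)

end

(* The substitution j \<mapsto> c with c^2 = -1 is a ring homomorphism onto the field of complex
   numbers. Its kernel is therefore maximal; it is I_1 for c = i and I_2 for c = -i. *)
theory Submission
  imports Defs
begin

text \<open>For c = \<plusminus> i, evaluating z + j w at j = c (\<open>bc_eval\<close>) is
  multiplicative because c and j have the same square. Modulo its kernel every element is a complex
  scalar, and nonzero scalars are invertible, so no ideal lies strictly between the kernel and the
  ring (\<open>maximalideal_bc_eval_kernel\<close>). Evaluation at i kills \<open>bc_e1\<close>, and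
  \<open>bc_e1\<close> acts as the identity on the kernel, so the kernel is \<open>bc_I1\<close>;
  likewise for -i and \<open>bc_e2\<close>.\<close>

lemmas bicomplex_ring_defs = zero_bicomplex_def one_bicomplex_def plus_bicomplex_def
  minus_bicomplex_def times_bicomplex_def

definition bc_eval :: "complex \<Rightarrow> bicomplex \<Rightarrow> complex" where
  "bc_eval c x = bc_fst x + c * bc_snd x"

lemma bc_eval_simps [simp]:
  "bc_eval c 0 = 0"
  "bc_eval c 1 = 1"
  "bc_eval c (x + y) = bc_eval c x + bc_eval c y"
  "bc_eval c (x - y) = bc_eval c x - bc_eval c y"
  "bc_eval c (bc_of_complex z) = z"
  by (simp_all add: bc_eval_def bicomplex_ring_defs bc_of_complex_def algebra_simps)

lemma bc_eval_mult:
  assumes "c * c = - 1"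
  shows "bc_eval c (x * y) = bc_eval c x * bc_eval c y"
proof -
  \<comment> \<open>\<open>algebra_simps\<close> nests products to the right, so the square of c
    appears in this shape.\<close>
  have sq: "c * (c * u) = - u" for u
    using assms by (metis mult.assoc mult_minus1)
  show ?thesis
    by (simp add: bc_eval_def times_bicomplex_def algebra_simps) (simp add: sq)
qed

lemma maximalideal_bc_eval_kernel:
  assumes c: "c * c = - 1" and I: "ideal {x. bc_eval c x = 0} BC"
  shows "maximalideal {x. bc_eval c x = 0} BC"
proof (rule maximalidealI [OF I])
  have "bc_eval c 1 \<noteq> 0"
    by simp
  then show "carrier BC \<noteq> {x. bc_eval c x = 0}"
    by (metis BC_simps(1) UNIV_I mem_Collect_eq)
next
  fix J
  assume J: "ideal J BC" and sub: "{x. bc_eval c x = 0} \<subseteq> J"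
  have "J = UNIV" if ne: "J \<noteq> {x. bc_eval c x = 0}"
  proof -
    obtain a where a: "a \<in> J" "bc_eval c a \<noteq> 0"
      using sub ne by blast
    have "x \<in> J" for x
    proof -
      \<comment> \<open>The scalar is chosen so that y, a multiple of a, has the same value as x;
        then x - y lies in the kernel.\<close>
      define y where "y = bc_of_complex (bc_eval c x / bc_eval c a) * a"
      have "y \<in> J"
        using ideal.I_l_closed [OF J a(1)] by (simp add: y_def)
      moreover have "x - y \<in> J"
        using sub a(2) by (auto simp: y_def bc_eval_mult [OF c])
      ultimately have "(x - y) + y \<in> J"
        using additive_subgroup.a_closed [OF ideal.axioms(1) [OF J]] by fastforce
      then show ?thesis
        by simp
    qed
    then show ?thesis
      by blast
  qed
  then show "J = {x. bc_eval c x = 0} \<or> J = carrier BC"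
    by auto
qed

text \<open>\<open>bc_e1\<close> takes the value (1 + i * i) / 2 = 0 at j = i, hence so does each
  multiple of it.\<close>

lemma bc_I1_eq_kernel: "bc_I1 = {x. bc_eval \<i> x = 0}"
proof (intro equalityI subsetI)
  fix x
  assume "x \<in> bc_I1"
  then show "x \<in> {x. bc_eval \<i> x = 0}"
    by (auto simp: bc_I1_def bc_eval_mult) (simp add: bc_eval_def bc_e1_def bc_i_def bc_j_def
      bc_of_complex_def bicomplex_ring_defs)
next
  fix x
  assume "x \<in> {x. bc_eval \<i> x = 0}"
  then have "bc_fst x = - \<i> * bc_snd x"
    by (simp add: bc_eval_def eq_neg_iff_add_eq_0)
  \<comment> \<open>A kernel element is w (j - i), and \<open>bc_e1\<close> fixes j - i since
    \<open>bc_e1\<close> * j = (j - i) / 2 = - i * \<open>bc_e1\<close>.\<close>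
  then have "x = bc_e1 * x"
    by (intro bicomplex.expand) (simp add: bc_e1_def bc_i_def bc_j_def bc_of_complex_def
      bicomplex_ring_defs algebra_simps)
  then show "x \<in> bc_I1"
    by (auto simp: bc_I1_def)
qed

lemma bc_I2_eq_kernel: "bc_I2 = {x. bc_eval (- \<i>) x = 0}"
proof (intro equalityI subsetI)
  fix x
  assume "x \<in> bc_I2"
  then show "x \<in> {x. bc_eval (- \<i>) x = 0}"
    by (auto simp: bc_I2_def bc_eval_mult) (simp add: bc_eval_def bc_e2_def bc_i_def bc_j_def
      bc_of_complex_def bicomplex_ring_defs)
next
  fix x
  assume "x \<in> {x. bc_eval (- \<i>) x = 0}"
  then have "bc_fst x = \<i> * bc_snd x"
    by (simp add: bc_eval_def)
  \<comment> \<open>Now x = w (j + i), and \<open>bc_e2\<close> fixes j + i.\<close>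
  then have "x = bc_e2 * x"
    by (intro bicomplex.expand) (simp add: bc_e2_def bc_i_def bc_j_def bc_of_complex_def
      bicomplex_ring_defs algebra_simps)
  then show "x \<in> bc_I2"
    by (auto simp: bc_I2_def)
qed

theorem mainTheorem4:
  shows "maximalideal bc_I1 BC \<and> maximalideal bc_I2 BC"
proof
  have "ideal bc_I1 BC"
    \<comment> \<open>The kernel is known to be an ideal through its form as a principal
      ideal.\<close>
    by (simp add: bc_I1_cgenideal cring.cgenideal_ideal [OF cring_BC])
  then show "maximalideal bc_I1 BC"
    unfolding bc_I1_eq_kernel by (intro maximalideal_bc_eval_kernel) simp_all
next
  have "ideal bc_I2 BC"
    by (simp add: bc_I2_cgenideal cring.cgenideal_ideal [OF cring_BC])
  then show "maximalideal bc_I2 BC"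
    unfolding bc_I2_eq_kernel by (intro maximalideal_bc_eval_kernel) simp_all
qed

end
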